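(* Let $\lambda_B$ be the main eigenvalue of the random Ruelle operator $\mathscr{L}_{B_{t(\cdot)}}$ associated to the Brownian potential. Then almost surely $$\lambda_B=1+\exp(B_{\frac12})\lim_{n\to\infty}\frac{\mathscr{L}^n_{B_{t(\cdot)}}(1)(1,0,0,\ldots)}{\mathscr{L}^n_{B_{t(\cdot)}}(1)(0,0,0,\ldots)}.$$
   Context: Let $\Omega=\{0,1\}^{\mathbb{N}}$ with $\mathbb{N}=\{1,2,\ldots\}$, a compact metric space with the metric $d(x,y)=2^{-N}$, $N=\inf\{i\in\mathbb{N}: x_i\neq y_i\}$. $C(\Omega)$ is the space of real continuous functions on $\Omega$ with the supremum norm. For $f\in C(\Omega)$ the Ruelle operator $\mathscr{L}_f:C(\Omega)\to C(\Omega)$ is $\mathscr{L}_f(\varphi)(x)=\sum_{a=0,1}\exp(f(ax))\varphi(ax)$, where $ax=(a,x_1,x_2,\ldots)$; $\mathscr{L}^n_f(1)$ is the $n$-th iterate applied to the constant function $1$. Define $t:\Omega\to[0,1]$ by $t(x)=\sum_{n\ge1}2^{-n}x_n$. Let $\{B_s:s\in[0,1]\}$ be a standard one-dimensional Brownian motion (with $B_0=0$ and almost surely continuous paths) on a complete probability space. The Brownian potential is the random function $x\mapsto B_{t(x)}$ on $\Omega$; it is almost surely $\gamma$-Hölder continuous for every $0<\gamma<1/2$, and almost surely the spectral radius $\lambda_B$ of $\mathscr{L}_{B_{t(\cdot)}}$ on $C(\Omega)$ is an eigenvalue of this operator, called the main eigenvalue. *)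

theory Defs
  imports "HOL-Probability.Probability"
begin

section \<open>The symbolic space\<close>

text \<open>
  A point \<open>x = (x\<^sub>1, x\<^sub>2, \<dots>)\<close> of \<open>\<Omega> = {0,1}\<^sup>\<nat>\<close> is a function \<open>nat \<Rightarrow> bool\<close> with \<open>True\<close> for the
  symbol 1 and \<open>x n\<close> for the coordinate of (one-based) index \<open>n + 1\<close>. The prefixed sequence
  \<open>(a, x\<^sub>1, x\<^sub>2, \<dots>)\<close> is \<open>case_nat a x\<close>. The type carries the product topology, which is
  the topology of the metric \<open>omega_dist\<close> (lemma \<open>open_omega_iff\<close>).
\<close>

type_synonym omega = "nat \<Rightarrow> bool"

definition omega_dist :: "omega \<Rightarrow> omega \<Rightarrow> real" where
  "omega_dist x y = (if x = y then 0 else (1/2) ^ Suc (LEAST i. x i \<noteq> y i))"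

lemma omega_dist_less_iff: "omega_dist x y < (1/2) ^ n \<longleftrightarrow> (\<forall>i<n. x i = y i)"
proof (cases "x = y")
  case True
  then show ?thesis by (simp add: omega_dist_def)
next
  case False
  define m where "m = (LEAST i. x i \<noteq> y i)"
  obtain j where "x j \<noteq> y j" using False by blast
  then have m: "x m \<noteq> y m" unfolding m_def by (rule LeastI)
  have less: "x i = y i" if "i < m" for i
    using not_less_Least[of i "\<lambda>i. x i \<noteq> y i"] that unfolding m_def by blast
  have "omega_dist x y < (1/2) ^ n \<longleftrightarrow> n \<le> m"
    using False power_strict_decreasing_iff[of "1/2 :: real" "Suc m" n]
    unfolding omega_dist_def m_def[symmetric] by (simp add: less_Suc_eq_le)
  also have "\<dots> \<longleftrightarrow> (\<forall>i<n. x i = y i)"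
    using m less by (meson less_le_trans not_le)
  finally show ?thesis .
qed

lemma open_omega_iff:
  fixes U :: "omega set"
  shows "open U \<longleftrightarrow> (\<forall>x\<in>U. \<exists>e>0. \<forall>y. omega_dist x y < e \<longrightarrow> y \<in> U)"
proof
  assume U: "open U"
  show "\<forall>x\<in>U. \<exists>e>0. \<forall>y. omega_dist x y < e \<longrightarrow> y \<in> U"
  proof
    fix x assume "x \<in> U"
    moreover have "openin (product_topology (\<lambda>_. euclidean) UNIV) U"
      using U by (simp only: open_fun_def)
    ultimately obtain X where X: "x \<in> Pi\<^sub>E UNIV X" "finite {i. X i \<noteq> UNIV}" "Pi\<^sub>E UNIV X \<subseteq> U"
      using product_topology_open_contains_basis[of "\<lambda>_. euclidean" UNIV U x]
      unfolding topspace_euclidean by blast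
    obtain n where n: "{i. X i \<noteq> UNIV} \<subseteq> {..<n}"
      using finite_nat_iff_bounded X(2) by blast
    have "y \<in> U" if y: "omega_dist x y < (1/2) ^ n" for y
    proof -
      have eq: "x i = y i" if "i < n" for i
        using omega_dist_less_iff[THEN iffD1, OF y] that by blast
      have "y i \<in> X i" for i
      proof (cases "i < n")
        case True
        then show ?thesis using PiE_mem[OF X(1), of i] by (simp add: eq)
      next
        case False
        then show ?thesis using n by auto
      qed
      then show ?thesis using X(3) by auto
    qed
    then show "\<exists>e>0. \<forall>y. omega_dist x y < e \<longrightarrow> y \<in> U"
      by (intro exI[of _ "(1/2) ^ n"]) auto
  qed
next
  assume *: "\<forall>x\<in>U. \<exists>e>0. \<forall>y. omega_dist x y < e \<longrightarrow> y \<in> U"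
  show "open U"
  proof (subst open_subopen, intro ballI)
    fix x assume "x \<in> U"
    then obtain e where e: "e > 0" "\<And>y. omega_dist x y < e \<Longrightarrow> y \<in> U" using * by blast
    obtain n where n: "(1/2) ^ n < e"
      using real_arch_pow_inv[of e "1/2"] e(1) by auto
    define V where "V = {y :: omega. \<forall>i\<in>{..<n}. y i \<in> {x i}}"
    have "open V"
      unfolding V_def by (rule product_topology_basis'[where x = "\<lambda>i. i"]) (simp_all add: Topological_Spaces.open_discrete)
    moreover have "x \<in> V" by (simp add: V_def)
    moreover have "V \<subseteq> U"
    proof
      fix y assume "y \<in> V"
      then have "omega_dist x y < (1/2) ^ n"
        by (intro omega_dist_less_iff[THEN iffD2]) (auto simp: V_def)
      then show "y \<in> U" using e(2) n by simp
    qed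
    ultimately show "\<exists>T. open T \<and> x \<in> T \<and> T \<subseteq> U" by blast
  qed
qed

lemma compact_UNIV_omega: "compact (UNIV :: omega set)"
proof -
  have "compact_space (product_topology (\<lambda>_::nat. euclidean :: bool topology) UNIV)"
    by (subst compact_space_product_topology)
      (auto simp: compact_space_def finite_imp_compact)
  then show ?thesis
    by (simp add: euclidean_product_topology compact_space_def)
qed

lemma continuous_imp_bcontfun_omega:
  fixes f :: "omega \<Rightarrow> real"
  assumes "continuous_on UNIV f"
  shows "f \<in> bcontfun"
  using compact_continuous_image[OF assms compact_UNIV_omega]
  by (simp add: bcontfun_def assms compact_imp_bounded)

lemma continuous_on_case_nat: "continuous_on UNIV (\<lambda>x :: omega. case_nat a x :: omega)"
proof (rule continuous_on_coordinatewise_then_product)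
  fix i show "continuous_on UNIV (\<lambda>x :: omega. (case_nat a x :: omega) i)"
    by (cases i) (auto intro: continuous_on_const continuous_on_product_coordinates)
qed

section \<open>The Ruelle operator\<close>

text \<open>
  By compactness, \<open>omega \<Rightarrow>\<^sub>C real\<close> is the space of all real continuous functions on \<open>\<Omega>\<close>; its
  norm is the supremum norm.
\<close>

definition ruelle :: "(omega \<Rightarrow>\<^sub>C real) \<Rightarrow> (omega \<Rightarrow>\<^sub>C real) \<Rightarrow> (omega \<Rightarrow>\<^sub>C real)" where
  "ruelle f \<phi> =
     Bcontfun (\<lambda>x. \<Sum>a\<in>(UNIV :: bool set). exp (f (case_nat a x)) * \<phi> (case_nat a x))"

lemma apply_ruelle:
  "apply_bcontfun (ruelle f \<phi>) x =
     (\<Sum>a\<in>(UNIV :: bool set). exp (f (case_nat a x)) * \<phi> (case_nat a x))"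
proof -
  have "continuous_on UNIV (\<lambda>x. apply_bcontfun g (case_nat a x))" for g :: "omega \<Rightarrow>\<^sub>C real" and a
    by (rule continuous_on_compose2[OF continuous_on_apply_bcontfun continuous_on_case_nat]) auto
  then have "continuous_on UNIV
      (\<lambda>x. \<Sum>a\<in>(UNIV :: bool set). exp (f (case_nat a x)) * \<phi> (case_nat a x))"
    by (intro continuous_intros)
  then show ?thesis
    unfolding ruelle_def by (subst Bcontfun_inverse) (auto intro: continuous_imp_bcontfun_omega)
qed

lemma linear_ruelle: "linear (ruelle f)"
  by (rule linearI; rule bcontfun_eqI)
    (simp_all add: apply_ruelle algebra_simps sum.distrib sum_distrib_left)

lemma bounded_linear_ruelle: "bounded_linear (ruelle f)"
proof (rule bounded_linear_intro)
  show "ruelle f (x + y) = ruelle f x + ruelle f y" for x y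
    using linear_ruelle by (rule linear_add)
  show "ruelle f (r *\<^sub>R x) = r *\<^sub>R ruelle f x" for r x
    using linear_ruelle by (rule linear_scale)
  show "norm (ruelle f \<phi>) \<le> norm \<phi> * (2 * exp (norm f))" for \<phi>
  proof (rule norm_bound)
    fix x
    have "\<bar>exp (f y) * \<phi> y\<bar> \<le> exp (norm f) * norm \<phi>" for y
      using norm_bounded[of f y] norm_bounded[of \<phi> y] by (auto simp: abs_mult intro!: mult_mono)
    then have "\<bar>ruelle f \<phi> x\<bar> \<le> (\<Sum>a\<in>(UNIV :: bool set). exp (norm f) * norm \<phi>)"
      unfolding apply_ruelle by (intro order_trans[OF sum_abs] sum_mono)
    then show "norm (ruelle f \<phi> x) \<le> norm \<phi> * (2 * exp (norm f))" by (simp add: algebra_simps)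
  qed
qed

section \<open>Spectrum, spectral radius and main eigenvalue\<close>

text \<open>
  The spectrum of an operator \<open>T\<close> on a real space is that of its complexification:
  a pair \<open>(u, v)\<close> stands for \<open>u + \<i>v\<close>, and the resolvent set consists of those \<open>z\<close> for which
  \<open>z - T\<close> has a bounded inverse. Real linearity of the inverse is enough, as the inverse of
  a complex linear bijection is complex linear.
\<close>

definition complexified_shift ::
  "('a::real_normed_vector \<Rightarrow> 'a) \<Rightarrow> complex \<Rightarrow> 'a \<times> 'a \<Rightarrow> 'a \<times> 'a" where
  "complexified_shift T z = (\<lambda>(u, v).
     (Re z *\<^sub>R u - Im z *\<^sub>R v - T u, Im z *\<^sub>R u + Re z *\<^sub>R v - T v))"

definition spectrum :: "('a::real_normed_vector \<Rightarrow> 'a) \<Rightarrow> complex set" where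
  "spectrum T = {z. \<not> (\<exists>R. bounded_linear R \<and>
     R \<circ> complexified_shift T z = id \<and> complexified_shift T z \<circ> R = id)}"

definition spectral_radius :: "('a::real_normed_vector \<Rightarrow> 'a) \<Rightarrow> real" where
  "spectral_radius T = (SUP z\<in>spectrum T. cmod z)"

definition is_eigenvalue :: "('a::real_normed_vector \<Rightarrow> 'a) \<Rightarrow> real \<Rightarrow> bool" where
  "is_eigenvalue T l \<longleftrightarrow> (\<exists>h. h \<noteq> 0 \<and> T h = l *\<^sub>R h)"

text \<open>Unspecified when the spectral radius is not an eigenvalue.\<close>

definition main_eigenvalue :: "('a::real_normed_vector \<Rightarrow> 'a) \<Rightarrow> real" where
  "main_eigenvalue T = (THE l. l = spectral_radius T \<and> is_eigenvalue T l)"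

section \<open>Brownian motion and the Brownian potential\<close>

locale brownian_motion_01 = prob_space M + complete_measure M for M :: "'w measure" +
  fixes B :: "real \<Rightarrow> 'w \<Rightarrow> real"
  assumes random_variable: "t \<in> {0..1} \<Longrightarrow> B t \<in> borel_measurable M"
    and start: "AE \<omega> in M. B 0 \<omega> = 0"
    and gaussian_increments: "0 \<le> s \<Longrightarrow> s < t \<Longrightarrow> t \<le> 1 \<Longrightarrow>
      distributed M lborel (\<lambda>\<omega>. B t \<omega> - B s \<omega>) (normal_density 0 (sqrt (t - s)))"
    and independent_increments: "strict_mono_on {..n} \<tau> \<Longrightarrow> \<tau> ` {..n} \<subseteq> {0..1} \<Longrightarrow>
      indep_vars (\<lambda>_. borel) (\<lambda>i \<omega>. B (\<tau> (Suc i)) \<omega> - B (\<tau> i) \<omega>) {..<n::nat}"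
    and continuous_paths: "AE \<omega> in M. continuous_on {0..1} (\<lambda>t. B t \<omega>)"

definition binary_value :: "omega \<Rightarrow> real" where
  "binary_value x = (\<Sum>n. (1/2) ^ Suc n * of_bool (x n))"

text \<open>
  The potential \<open>x \<mapsto> B\<^bsub>t(x)\<^esub>\<close> as an element of \<open>C(\<Omega>)\<close>; unspecified for the null set of
  \<open>\<omega>\<close> whose path does not make it continuous (lemma \<open>apply_brownian_potential\<close>).
\<close>

definition brownian_potential :: "(real \<Rightarrow> 'w \<Rightarrow> real) \<Rightarrow> 'w \<Rightarrow> omega \<Rightarrow>\<^sub>C real" where
  "brownian_potential B \<omega> = Bcontfun (\<lambda>x. B (binary_value x) \<omega>)"

lemma summable_binary_value: "summable (\<lambda>n. (1/2) ^ Suc n * of_bool (x n) :: real)"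
  by (rule summable_comparison_test'[of "\<lambda>n. (1/2) ^ n" 0])
    (auto simp: summable_geometric)

lemma binary_value_in_01: "binary_value x \<in> {0..1}"
proof -
  have "binary_value x \<le> (\<Sum>n. (1/2) ^ Suc n)"
    unfolding binary_value_def
    by (intro suminf_le summable_binary_value) (auto intro!: sums_summable[OF power_half_series])
  also have "\<dots> = 1" using power_half_series by (rule sums_unique[symmetric])
  finally show ?thesis
    unfolding binary_value_def by (simp only: atLeastAtMost_iff)
      (intro conjI suminf_nonneg summable_binary_value; simp)
qed

lemma continuous_on_binary_value: "continuous_on UNIV binary_value"
proof -
  have "continuous_on UNIV (\<lambda>x::omega. of_bool (x n) :: real)" for n
    by (rule continuous_on_compose2[of UNIV "of_bool :: bool \<Rightarrow> real" UNIV "\<lambda>x. x n"])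
      (auto intro: continuous_on_discrete continuous_on_product_coordinates)
  then have cont: "continuous_on UNIV (\<lambda>x. \<Sum>n<k. (1/2) ^ Suc n * of_bool (x n) :: real)" for k
    by (intro continuous_intros)
  have "uniform_limit UNIV (\<lambda>k x. \<Sum>n<k. (1/2) ^ Suc n * of_bool (x n) :: real)
      binary_value sequentially"
    unfolding binary_value_def
    by (rule Weierstrass_m_test[of _ _ "\<lambda>n. (1/2) ^ n"]) (auto simp: summable_geometric)
  from uniform_limit_theorem[OF _ this] cont show ?thesis by simp
qed

lemma apply_brownian_potential:
  assumes "continuous_on {0..1} (\<lambda>t. B t \<omega>)"
  shows "apply_bcontfun (brownian_potential B \<omega>) x = B (binary_value x) \<omega>"
proof -
  have "continuous_on UNIV (\<lambda>x. B (binary_value x) \<omega>)"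
    by (rule continuous_on_compose2[OF assms continuous_on_binary_value])
      (use binary_value_in_01 in blast)
  then show ?thesis
    unfolding brownian_potential_def
    by (simp add: Bcontfun_inverse continuous_imp_bcontfun_omega)
qed

end

theory Submission
  imports Defs
begin

text \<open>
  Almost surely the increments of \<open>B\<close> over dyadic intervals of length \<open>2\<^sup>-\<^sup>m\<close> are eventually at most
  \<open>(9/10)\<^sup>m\<close>, so the potential has summable variations. Then all \<open>L\<^sup>n 1\<close> have uniformly bounded
  distortion, and the quotients \<open>L\<^sup>m\<^sup>+\<^sup>k 1 / L\<^sup>k 1\<close> converge to constants as \<open>k \<rightarrow> \<infinity>\<close>, uniformly in
  \<open>m\<close>, because each further power of \<open>L\<close> averages them against weights that depend on the base
  point only up to a bounded factor. Hence the normalised \<open>L\<^sup>n 1\<close> form a Cauchy sequence, whose limit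
  \<open>h\<close> is a positive eigenfunction with eigenvalue \<open>l\<close>, say. Since \<open>h\<close> is bounded away from \<open>0\<close>, the
  norm of \<open>L\<^sup>n\<close> is at most a multiple of \<open>l\<^sup>n\<close>, and the Neumann series shows that \<open>l\<close> is the spectral
  radius. The formula is the eigenvalue equation at the point \<open>(0,0,\<dots>)\<close>, which is one of its own
  two preimages.
\<close>

text \<open>
  The libraries provide completeness of \<open>'a \<Rightarrow>\<^sub>C 'b\<close> only for metric domains; with this
  instance, \<open>omega\<close> becomes one.
\<close>

instantiation bool :: metric_space
begin

definition dist_bool :: "bool \<Rightarrow> bool \<Rightarrow> real" where
  "dist_bool a b = of_bool (a \<noteq> b)"

definition uniformity_bool :: "(bool \<times> bool) filter" where
  "uniformity_bool = (INF e\<in>{0<..}. principal {(x, y). dist x y < e})"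

instance
proof
  fix U :: "bool set"
  show "open U \<longleftrightarrow> (\<forall>x\<in>U. \<forall>\<^sub>F (x', y) in uniformity. x' = x \<longrightarrow> y \<in> U)"
  proof -
    have "\<forall>\<^sub>F (x', y) in (uniformity :: (bool \<times> bool) filter). x' = y"
      unfolding uniformity_bool_def
      by (rule eventually_INF1[of 1]) (auto simp: eventually_principal dist_bool_def of_bool_def split: if_splits)
    then have "\<forall>\<^sub>F (x', y) in (uniformity :: (bool \<times> bool) filter). x' = x \<longrightarrow> y \<in> U"
      if "x \<in> U" for x
      by (rule eventually_mono) (use that in auto)
    then show ?thesis
      by (auto simp: Topological_Spaces.open_discrete)
  qed
qed (auto simp: dist_bool_def uniformity_bool_def)

end

instance bcontfun :: (metric_space, banach) banach ..

section \<open>Potentials of summable variation\<close>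

lemma ruelle_expand:
  "apply_bcontfun (ruelle f \<phi>) x =
     exp (f (case_nat False x)) * \<phi> (case_nat False x) + exp (f (case_nat True x)) * \<phi> (case_nat True x)"
  by (simp add: apply_ruelle UNIV_bool)

lemma linear_ruelle_power: "linear (ruelle f ^^ n)"
proof (induction n)
  case 0
  then show ?case by (simp add: linear_id id_def[symmetric])
next
  case (Suc n)
  then show ?case unfolding funpow.simps by (rule linear_compose) (rule linear_ruelle)
qed

lemma ruelle_power_nonneg:
  assumes "\<And>x. 0 \<le> apply_bcontfun \<phi> x"
  shows "0 \<le> apply_bcontfun ((ruelle f ^^ n) \<phi>) x"
  using assms by (induction n arbitrary: x) (simp_all add: ruelle_expand)

lemma ruelle_power_pos:
  assumes "\<And>x. 0 < apply_bcontfun \<phi> x"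
  shows "0 < apply_bcontfun ((ruelle f ^^ n) \<phi>) x"
  using assms by (induction n arbitrary: x) (simp_all add: ruelle_expand add_pos_pos)

lemma ruelle_power_mono:
  assumes "\<And>x. apply_bcontfun \<phi> x \<le> apply_bcontfun \<psi> x"
  shows "apply_bcontfun ((ruelle f ^^ n) \<phi>) x \<le> apply_bcontfun ((ruelle f ^^ n) \<psi>) x"
  using ruelle_power_nonneg[of "\<psi> - \<phi>" n f x] assms
  by (simp add: linear_diff[OF linear_ruelle_power])

locale summable_variation =
  fixes f :: "omega \<Rightarrow>\<^sub>C real" and v :: "nat \<Rightarrow> real"
  assumes summable_v: "summable v"
    and variation: "(\<And>i. i < n \<Longrightarrow> x i = y i) \<Longrightarrow> \<bar>f x - f y\<bar> \<le> v n"
begin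

text \<open>After prefixing \<open>i + 1\<close> common symbols, points that share \<open>n\<close>
  coordinates share \<open>i + Suc n\<close>. So \<open>tail n\<close> bounds the total variation of
  \<open>f\<close> picked up along arbitrarily long inverse branches.\<close>

definition tail :: "nat \<Rightarrow> real" where
  "tail n = (\<Sum>i. v (i + Suc n))"

definition iter_one :: "nat \<Rightarrow> (omega \<Rightarrow>\<^sub>C real)" where
  "iter_one n = (ruelle f ^^ n) (const_bcontfun 1)"

lemma v_nonneg: "0 \<le> v n"
  using variation[of n undefined undefined] by simp

lemma summable_tail: "summable (\<lambda>i. v (i + n))"
  using summable_v by (rule summable_ignore_initial_segment)

lemma tail_Suc: "tail n = v (Suc n) + tail (Suc n)"
  using suminf_split_head[OF summable_tail[of "Suc n"]] by (simp add: tail_def)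

lemma tail_antimono: "m \<le> n \<Longrightarrow> tail n \<le> tail m"
proof (rule lift_Suc_antimono_le[of tail])
  show "tail (Suc n) \<le> tail n" for n
    using tail_Suc[of n] v_nonneg[of "Suc n"] by linarith
qed

lemma tail_nonneg: "0 \<le> tail n"
  unfolding tail_def by (intro suminf_nonneg summable_tail v_nonneg)

lemma tail_tendsto: "tail \<longlonglongrightarrow> 0"
proof -
  have "(\<lambda>n. \<Sum>i. v (i + n)) \<longlonglongrightarrow> 0"
    by (rule suminf_exist_split2[OF summable_v])
  then show ?thesis
    unfolding tail_def by (rule LIMSEQ_Suc)
qed

section \<open>Comparison of iterates at two base points\<close>

lemma exp_variation:
  assumes "\<And>i. i < n \<Longrightarrow> x i = y i"
  shows "exp (- v (Suc n)) * exp (f (case_nat a y)) \<le> exp (f (case_nat a x))"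
proof -
  have "\<bar>f (case_nat a x) - f (case_nat a y)\<bar> \<le> v (Suc n)"
    by (rule variation) (use assms in \<open>auto split: nat.split\<close>)
  then have "- v (Suc n) + f (case_nat a y) \<le> f (case_nat a x)"
    by linarith
  then show ?thesis
    by (simp flip: exp_add)
qed

text \<open>
  The comparison of \<open>\<phi>\<close> and \<open>\<psi>\<close> is only required for nearby points. With \<open>\<phi> = \<psi> = 1\<close> this is
  bounded distortion; for general \<open>\<phi>\<close>, \<open>\<psi>\<close> it is a Doeblin condition.
\<close>

lemma ruelle_power_comparison:
  assumes "\<And>x y. (\<And>i. i < j + n \<Longrightarrow> x i = y i) \<Longrightarrow> \<kappa> * apply_bcontfun \<psi> y \<le> apply_bcontfun \<phi> x"
    and "\<And>y. 0 \<le> apply_bcontfun \<psi> y" and "0 \<le> \<kappa>"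
    and "\<And>i. i < j \<Longrightarrow> x i = y i"
  shows "\<kappa> * exp (tail (j + n) - tail j) * apply_bcontfun ((ruelle f ^^ n) \<psi>) y
    \<le> apply_bcontfun ((ruelle f ^^ n) \<phi>) x"
  using assms
proof (induction n arbitrary: \<kappa> \<phi> \<psi> x y)
  case 0
  then show ?case by simp
next
  case (Suc n)
  \<comment> \<open>The induction peels off the innermost \<open>ruelle f\<close>: prefixing a
    symbol turns agreement in \<open>j + n\<close> coordinates into the \<open>j + Suc n\<close>
    required of \<open>\<phi>\<close> and \<open>\<psi>\<close>. The induction hypothesis then
    applies to \<open>ruelle f \<phi>\<close> and \<open>ruelle f \<psi>\<close>, with
    \<open>\<kappa>\<close> reduced by one summand of the tail.\<close>
  have step: "\<kappa> * exp (- v (Suc (j + n))) * apply_bcontfun (ruelle f \<psi>) y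
      \<le> apply_bcontfun (ruelle f \<phi>) x" if eq: "\<And>i. i < j + n \<Longrightarrow> x i = y i" for x y
  proof -
    have "(exp (- v (Suc (j + n))) * exp (f (case_nat a y))) * (\<kappa> * \<psi> (case_nat a y))
        \<le> exp (f (case_nat a x)) * \<phi> (case_nat a x)" for a
      by (intro mult_mono exp_variation Suc.prems(1))
        (use eq Suc.prems(2,3) in \<open>auto split: nat.split\<close>)
    from this[of False] this[of True] show ?thesis
      by (simp add: ruelle_expand algebra_simps)
  qed
  have nonneg: "0 \<le> apply_bcontfun (ruelle f \<psi>) y" for y
    using Suc.prems(2) by (simp add: ruelle_expand)
  have "(\<kappa> * exp (- v (Suc (j + n)))) * exp (tail (j + n) - tail j)
      * apply_bcontfun ((ruelle f ^^ n) (ruelle f \<psi>)) y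
    \<le> apply_bcontfun ((ruelle f ^^ n) (ruelle f \<phi>)) x"
    by (rule Suc.IH) (use step nonneg Suc.prems(3,4) in auto)
  moreover have "exp (- v (Suc (j + n))) * exp (tail (j + n) - tail j)
      = exp (tail (j + Suc n) - tail j)"
    using tail_Suc[of "j + n"] by (simp flip: exp_add)
  ultimately show ?case
    by (simp add: funpow_swap1 mult.assoc)
qed

lemma iter_one_pos: "0 < apply_bcontfun (iter_one n) x"
  unfolding iter_one_def by (rule ruelle_power_pos) (simp add: const_bcontfun.rep_eq)

lemma iter_one_add: "(ruelle f ^^ n) (iter_one k) = iter_one (k + n)"
  unfolding iter_one_def by (metis add.commute comp_apply funpow_add)

text \<open>Dropping the factor \<open>exp (tail (j + n))\<close>, which is at least 1, makes the
  constant independent of \<open>n\<close>. For \<open>j = 0\<close> it compares arbitrary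
  points.\<close>

lemma iter_one_distortion:
  assumes "\<And>i. i < j \<Longrightarrow> x i = y i"
  shows "exp (- tail j) * iter_one n y \<le> iter_one n x"
proof -
  have "1 * exp (tail (j + n) - tail j) * apply_bcontfun (iter_one n) y \<le> apply_bcontfun (iter_one n) x"
    unfolding iter_one_def
    by (rule ruelle_power_comparison) (use assms in \<open>auto simp: const_bcontfun.rep_eq\<close>)
  moreover have "exp (- tail j) * iter_one n y \<le> exp (tail (j + n) - tail j) * iter_one n y"
    using tail_nonneg[of "j + n"] iter_one_pos[of n y] by (intro mult_right_mono) auto
  ultimately show ?thesis by simp
qed

section \<open>Contraction of the ratios of iterates\<close>

text \<open>The inequality bounds the quotient of any two values of \<open>L\<^sup>m\<^sup>+\<^sup>k 1 / L\<^sup>k 1\<close> from below by \<open>s\<close>.\<close>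

definition close_ratios :: "nat \<Rightarrow> real \<Rightarrow> bool" where
  "close_ratios k s \<longleftrightarrow> (\<forall>m x y. s * (iter_one (m + k) y * iter_one k x)
     \<le> iter_one (m + k) x * iter_one k y)"

text \<open>
  With \<open>b\<close> the infimum of the quotient \<open>F/G\<close>, the Doeblin condition is applied to the nonnegative
  function \<open>F - b G\<close>. The factor \<open>exp (- 2 * tail n)\<close> accounts for the variation of \<open>F/G\<close>
  between points that share \<open>n\<close> coordinates.
\<close>

lemma close_ratios_step:
  assumes "close_ratios k s" and "0 \<le> s"
  shows "close_ratios (k + n) (exp (- 2 * tail 0) + (exp (- 2 * tail n) - exp (- 2 * tail 0)) * s)"
  unfolding close_ratios_def
proof (intro allI)
  fix m x y
  define F G where "F = iter_one (m + k)" and "G = iter_one k"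
  define b where "b = (INF z. F z / G z)"
  define \<epsilon> where "\<epsilon> = exp (- tail n)"
  have Fpos: "0 < F z" and Gpos: "0 < G z" for z
    by (simp_all add: F_def G_def iter_one_pos)
  have bdd: "bdd_below (range (\<lambda>z. F z / G z))"
    by (rule bdd_belowI[of _ 0]) (auto intro: less_imp_le divide_pos_pos Fpos Gpos)
  have b_le: "b * G z \<le> F z" for z
    using cINF_lower[OF bdd, of z] Gpos[of z] by (simp add: b_def pos_le_divide_eq)
  have b_ge: "s * F z \<le> b * G z" for z
  proof -
    have "s * F z / G z \<le> b"
      unfolding b_def
    proof (rule cINF_greatest)
      fix w
      have "s * (F z * G w) \<le> F w * G z"
        using assms(1) by (simp add: close_ratios_def F_def G_def)
      then show "s * F z / G z \<le> F w / G w"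
        using Gpos[of z] Gpos[of w] by (simp add: field_simps)
    qed simp
    then show ?thesis using Gpos[of z] by (simp add: pos_divide_le_eq)
  qed
  have b_nonneg: "0 \<le> b"
    unfolding b_def by (rule cINF_greatest) (auto intro: less_imp_le divide_pos_pos Fpos Gpos)
  define F' G' where "F' = iter_one (m + (k + n))" and "G' = iter_one (k + n)"
  have F': "F' = (ruelle f ^^ n) F" and G': "G' = (ruelle f ^^ n) G"
    by (simp_all add: F'_def G'_def F_def G_def iter_one_add add.assoc)
  have F'pos: "0 < F' z" and G'pos: "0 < G' z" for z
    by (simp_all add: F'_def G'_def iter_one_pos)
  have lower: "b * G' z \<le> F' z" for z
    using ruelle_power_mono[of "b *\<^sub>R G" F n f z] b_le
    by (simp add: F' G' linear_scale[OF linear_ruelle_power])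
  have upper: "s * F' z \<le> b * G' z" for z
    using ruelle_power_mono[of "s *\<^sub>R F" "b *\<^sub>R G" n f z] b_ge
    by (simp add: F' G' linear_scale[OF linear_ruelle_power])
  \<comment> \<open>With \<open>j = 0\<close> the points \<open>x\<close> and \<open>y\<close> are
    unrelated; only their preimages share \<open>n\<close> coordinates. There the distortions of
    \<open>F\<close> and of \<open>G\<close> cost one factor \<epsilon> each, hence the coefficient
    \<open>\<epsilon>\<^sup>2 * b\<close>. The \<epsilon> on the left cancels
    \<open>exp (tail n)\<close>, which leaves \<open>exp (- tail 0)\<close>.\<close>
  have "\<epsilon> * exp (tail (0 + n) - tail 0) * apply_bcontfun ((ruelle f ^^ n) (F - b *\<^sub>R G)) y
      \<le> apply_bcontfun ((ruelle f ^^ n) (F - (\<epsilon>\<^sup>2 * b) *\<^sub>R G)) x"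
  proof (rule ruelle_power_comparison)
    fix x y :: omega assume eq: "\<And>i. i < 0 + n \<Longrightarrow> x i = y i"
    have "\<epsilon> * F y \<le> F x" "\<epsilon> * G x \<le> G y"
      unfolding \<epsilon>_def F_def G_def by (rule iter_one_distortion; use eq in auto)+
    then have "\<epsilon> * F y \<le> F x" "(\<epsilon> * b) * (\<epsilon> * G x) \<le> (\<epsilon> * b) * G y"
      using b_nonneg by (auto simp: \<epsilon>_def intro!: mult_left_mono)
    then show "\<epsilon> * apply_bcontfun (F - b *\<^sub>R G) y \<le> apply_bcontfun (F - (\<epsilon>\<^sup>2 * b) *\<^sub>R G) x"
      by (simp add: algebra_simps power2_eq_square)
  qed (use b_le in \<open>auto simp: \<epsilon>_def\<close>)
  then have main: "exp (- tail 0) * (F' y - b * G' y) \<le> F' x - \<epsilon>\<^sup>2 * b * G' x"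
    by (simp add: \<epsilon>_def F' G' linear_diff[OF linear_ruelle_power]
        linear_scale[OF linear_ruelle_power] flip: exp_add)
  define \<delta> where "\<delta> = exp (- 2 * tail 0)"
  have \<delta>: "\<delta> = exp (- tail 0) * exp (- tail 0)"
    by (simp add: \<delta>_def flip: exp_add)
  have \<epsilon>2: "\<epsilon>\<^sup>2 = exp (- 2 * tail n)"
    by (simp add: \<epsilon>_def power2_eq_square flip: exp_add)
  have \<delta>_le: "\<delta> \<le> \<epsilon>\<^sup>2"
    unfolding \<delta>_def \<epsilon>2 using tail_antimono[of 0 n] by simp
  \<comment> \<open>A second factor \<open>exp (- tail 0)\<close> trades \<open>G' y\<close> for
    \<open>G' x\<close>, so that the products \<open>F' y * G' x\<close> and
    \<open>F' x * G' y\<close> appear; \<delta> collects both factors.\<close>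
  have "exp (- tail 0) * G' x \<le> G' y"
    unfolding G'_def by (rule iter_one_distortion) simp
  then have "exp (- tail 0) * (F' y - b * G' y) * (exp (- tail 0) * G' x)
      \<le> exp (- tail 0) * (F' y - b * G' y) * G' y"
    using lower[of y] by (intro mult_left_mono) auto
  also have "\<dots> \<le> (F' x - \<epsilon>\<^sup>2 * b * G' x) * G' y"
    using main G'pos[of y] by (intro mult_right_mono) auto
  finally have "\<delta> * (F' y * G' x) + (\<epsilon>\<^sup>2 - \<delta>) * ((b * G' y) * G' x) \<le> F' x * G' y"
    by (simp add: \<delta> algebra_simps)
  moreover have "(\<epsilon>\<^sup>2 - \<delta>) * ((s * F' y) * G' x) \<le> (\<epsilon>\<^sup>2 - \<delta>) * ((b * G' y) * G' x)"
    using \<delta>_le upper[of y] G'pos[of x] by (intro mult_left_mono mult_right_mono) auto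
  ultimately have "(\<delta> + (\<epsilon>\<^sup>2 - \<delta>) * s) * (F' y * G' x) \<le> F' x * G' y"
    by (simp add: algebra_simps)
  then show "(exp (- 2 * tail 0) + (exp (- 2 * tail n) - exp (- 2 * tail 0)) * s)
      * (iter_one (m + (k + n)) y * iter_one (k + n) x)
      \<le> iter_one (m + (k + n)) x * iter_one (k + n) y"
    by (simp add: \<delta>_def \<epsilon>2 F'_def G'_def)
qed

lemma close_ratios_mono: "close_ratios k s \<Longrightarrow> r \<le> s \<Longrightarrow> close_ratios k r"
  unfolding close_ratios_def
  by (blast intro: order_trans[OF mult_right_mono] less_imp_le mult_pos_pos iter_one_pos)

text \<open>Without the variation term, a step of \<open>close_ratios_step\<close> would shrink the
  gap \<open>1 - s\<close> by the factor \<open>1 - \<delta>\<close>. Since \<open>tail n\<close>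
  tends to 0, \<open>n\<close> can be chosen, depending on \<open>s\<close>, so large that at most
  half of the gain \<open>\<delta> * (1 - s)\<close> is lost; the gap still shrinks by
  \<open>q = 1 - \<delta> / 2\<close>.\<close>

lemma ex_close_ratios:
  assumes "s < 1"
  shows "\<exists>k. close_ratios k s"
proof -
  define \<delta> where "\<delta> = exp (- 2 * tail 0)"
  define q where "q = 1 - \<delta> / 2"
  have \<delta>: "0 < \<delta>" "\<delta> \<le> 1"
    using tail_nonneg[of 0] by (auto simp: \<delta>_def)
  then have q: "0 < q" "q < 1" by (auto simp: q_def)
  obtain j where j: "q ^ j < 1 - s"
    using real_arch_pow_inv[of "1 - s" q] assms q by auto
  have "\<exists>k. close_ratios k (1 - q ^ j)"
  proof (induction j)
    case 0
    have "close_ratios 0 0"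
      unfolding close_ratios_def
      by (simp add: iter_one_pos less_imp_le)
    then show ?case by auto
  next
    case (Suc j)
    then obtain k where k: "close_ratios k (1 - q ^ j)" ..
    define s where "s = 1 - q ^ j"
    have s: "0 \<le> s" "s < 1" using q by (auto simp: s_def power_le_one)
    have "(\<lambda>n. (1 - exp (- 2 * tail n)) * s) \<longlonglongrightarrow> (1 - exp (- 2 * 0)) * s"
      by (intro tendsto_intros tail_tendsto)
    then have "(\<lambda>n. (1 - exp (- 2 * tail n)) * s) \<longlonglongrightarrow> 0" by simp
    moreover have "0 < \<delta> * (1 - s) / 2" using \<delta> s by simp
    ultimately have "\<forall>\<^sub>F n in sequentially. (1 - exp (- 2 * tail n)) * s < \<delta> * (1 - s) / 2"
      by (rule order_tendstoD(2))
    then obtain n where n: "(1 - exp (- 2 * tail n)) * s < \<delta> * (1 - s) / 2"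
      by (auto simp: eventually_sequentially)
    have "1 - q ^ Suc j = s + \<delta> * (1 - s) / 2"
      by (simp add: s_def q_def algebra_simps)
    also have "\<dots> \<le> \<delta> + (exp (- 2 * tail n) - \<delta>) * s"
      using n by (simp add: field_simps)
    finally have "close_ratios (k + n) (1 - q ^ Suc j)"
      using close_ratios_step[OF k[folded s_def] s(1), of n] unfolding \<delta>_def
      by (rule close_ratios_mono[rotated])
    then show ?case ..
  qed
  then obtain k where "close_ratios k (1 - q ^ j)" ..
  moreover have "s \<le> 1 - q ^ j" using j by simp
  ultimately show ?thesis using close_ratios_mono by blast
qed

section \<open>The positive eigenfunction\<close>

lemma ex_eigenfunction:
  "\<exists>c h l. 0 < c \<and> (\<forall>x. c \<le> apply_bcontfun h x) \<and> 0 < l \<and> ruelle f h = l *\<^sub>R h \<and>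
     (\<forall>x y. (\<lambda>n. iter_one n x / iter_one n y) \<longlonglongrightarrow> h x / h y)"
proof -
  define z :: omega where "z = (\<lambda>_. False)"
  define D where "D = exp (tail 0)"
  \<comment> \<open>Normalising at \<open>z\<close> keeps all \<open>g n\<close> between
    \<open>inverse D\<close> and \<open>D\<close>, by distortion with \<open>j = 0\<close>.\<close>
  define g where "g n = inverse (iter_one n z) *\<^sub>R iter_one n" for n
  note pos = iter_one_pos
  have g_apply: "g n x = iter_one n x / iter_one n z" for n x
    by (simp add: g_def divide_inverse)
  have D: "0 < D" by (simp add: D_def)
  have g_le: "g n x \<le> D" and g_ge: "inverse D \<le> g n x" for n x
    using iter_one_distortion[of 0 z x n] iter_one_distortion[of 0 x z n] pos[of n z] pos[of n x] D
    by (auto simp: g_apply D_def exp_minus field_simps)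
  \<comment> \<open>At each point, each of the two values is at least \<open>s\<close> times the
    other, so they differ by at most \<open>1 - s\<close> times a value that is bounded by
    \<open>D\<close>.\<close>
  have g_dist: "dist (g n) (g k) \<le> (1 - s) * D" if cl: "close_ratios k s" and s: "s \<le> 1" and "k \<le> n" for n k s
  proof (rule dist_bound)
    fix x
    obtain m where m: "n = m + k" using \<open>k \<le> n\<close> by (metis add.commute le_Suc_ex)
    have "s * (iter_one n z * iter_one k x) \<le> iter_one n x * iter_one k z"
      "s * (iter_one n x * iter_one k z) \<le> iter_one n z * iter_one k x"
      using cl unfolding close_ratios_def m by blast+
    then have "s * g k x \<le> g n x" "s * g n x \<le> g k x"
      using pos[of n z] pos[of k z] by (auto simp: g_apply field_simps)
    moreover have "(1 - s) * g n x \<le> (1 - s) * D" "(1 - s) * g k x \<le> (1 - s) * D"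
      using g_le s by (auto intro: mult_left_mono)
    ultimately show "dist (g n x) (g k x) \<le> (1 - s) * D"
      by (auto simp: dist_real_def abs_le_iff algebra_simps)
  qed
  have "Cauchy g"
  proof (rule metric_CauchyI)
    fix e :: real assume e: "0 < e"
    \<comment> \<open>This makes \<open>(1 - s) * D\<close> equal to \<open>e / 3\<close>; two such
      distances stay strictly below \<open>e\<close>.\<close>
    define s where "s = 1 - e / (3 * D)"
    have s: "s < 1" using e D by (simp add: s_def)
    then obtain k where k: "close_ratios k s" using ex_close_ratios by blast
    have near: "dist (g n) (g k) \<le> e / 3" if "k \<le> n" for n
      using g_dist[OF k _ that] s D by (simp add: s_def)
    have "dist (g m) (g n) < e" if "k \<le> m" "k \<le> n" for m n
      using near[OF that(1)] near[OF that(2)] dist_triangle2[of "g m" "g n" "g k"] e by linarith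
    then show "\<exists>M. \<forall>m\<ge>M. \<forall>n\<ge>M. dist (g m) (g n) < e" by blast
  qed
  then obtain h where h: "g \<longlonglongrightarrow> h"
    using Cauchy_convergent convergent_def by blast
  have eval: "(\<lambda>n. apply_bcontfun (F n) x) \<longlonglongrightarrow> apply_bcontfun H x"
    if "F \<longlonglongrightarrow> H" for F :: "nat \<Rightarrow> omega \<Rightarrow>\<^sub>C real" and H x
    using tendsto_bcontfun_uniform_limit[OF that] by (rule tendsto_uniform_limitI) simp
  have h_ge: "inverse D \<le> h x" for x
    using eval[OF h] by (rule LIMSEQ_le_const) (use g_ge in auto)
  define l where "l = ruelle f h z"
  have Lg: "(\<lambda>n. ruelle f (g n)) \<longlonglongrightarrow> ruelle f h"
    using bounded_linear_ruelle h by (rule bounded_linear.tendsto)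
  \<comment> \<open>Both sides are multiples of \<open>iter_one (Suc n)\<close>, and they agree at
    \<open>z\<close> because \<open>g (Suc n)\<close> is 1 there. In the limit this becomes the
    eigenvalue equation.\<close>
  have step: "ruelle f (g n) = ruelle f (g n) z *\<^sub>R g (Suc n)" for n
  proof -
    have "ruelle f (iter_one n) = iter_one (Suc n)"
      by (simp add: iter_one_def)
    then show ?thesis
      using pos[of "Suc n" z] by (simp add: g_def linear_scale[OF linear_ruelle])
  qed
  have "(\<lambda>n. ruelle f (g n) z *\<^sub>R g (Suc n)) \<longlonglongrightarrow> l *\<^sub>R h"
    unfolding l_def by (intro tendsto_scaleR eval Lg LIMSEQ_Suc h)
  then have "ruelle f h = l *\<^sub>R h"
    using Lg step by (metis (no_types, lifting) LIMSEQ_unique ext)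
  moreover have "0 < l"
    using h_ge D unfolding l_def ruelle_expand
    by (intro add_pos_pos mult_pos_pos) (auto intro: less_le_trans[of _ "inverse D"])
  moreover have "(\<lambda>n. iter_one n x / iter_one n y) \<longlonglongrightarrow> h x / h y" for x y
  proof -
    have "0 < h y" using h_ge[of y] D by (auto intro: less_le_trans[of _ "inverse D"])
    then have "(\<lambda>n. g n x / g n y) \<longlonglongrightarrow> h x / h y"
      by (intro tendsto_divide eval h) auto
    moreover have "g n x / g n y = iter_one n x / iter_one n y" for n
      using pos[of n z] by (simp add: g_apply)
    ultimately show ?thesis by simp
  qed
  ultimately show ?thesis
    using h_ge D by (intro exI[of _ "inverse D"] exI[of _ h] exI[of _ l]) simp
qed

end

text \<open>Since \<open>h\<close> is at least \<open>c\<close>, \<phi> lies between the multiples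
  \<open>- K * h\<close> and \<open>K * h\<close> with \<open>K = norm \<phi> / c\<close>.
  Positivity preserves this order, and on \<open>h\<close> the powers are explicit.\<close>

lemma norm_ruelle_power_le:
  assumes "0 < c" "\<And>x. c \<le> apply_bcontfun h x" "0 < l" "ruelle f h = l *\<^sub>R h"
  shows "norm ((ruelle f ^^ n) \<phi>) \<le> norm h / c * l ^ n * norm \<phi>"
proof (rule norm_bound)
  fix x
  define K where "K = norm \<phi> / c"
  have Lh: "(ruelle f ^^ n) h = l ^ n *\<^sub>R h"
    by (induction n) (simp_all add: assms(4) linear_scale[OF linear_ruelle])
  have K: "\<bar>\<phi> y\<bar> \<le> K * h y" "0 \<le> K" for y
  proof -
    have "\<bar>\<phi> y\<bar> \<le> norm \<phi>" using norm_bounded[of \<phi> y] by simp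
    also have "\<dots> = K * c" using assms(1) by (simp add: K_def)
    also have "\<dots> \<le> K * h y"
      using assms(1,2) by (intro mult_left_mono) (auto simp: K_def)
    finally show "\<bar>\<phi> y\<bar> \<le> K * h y" .
    show "0 \<le> K" using assms(1) by (simp add: K_def)
  qed
  have "(ruelle f ^^ n) \<phi> x \<le> (ruelle f ^^ n) (K *\<^sub>R h) x"
    "(ruelle f ^^ n) (- (K *\<^sub>R h)) x \<le> (ruelle f ^^ n) \<phi> x"
    by (rule ruelle_power_mono; use K(1) in \<open>simp add: abs_le_iff minus_le_iff\<close>)+
  then have "\<bar>(ruelle f ^^ n) \<phi> x\<bar> \<le> K * (l ^ n * h x)"
    by (simp add: Lh linear_scale[OF linear_ruelle_power] linear_neg[OF linear_ruelle_power] abs_le_iff)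
  also have "\<dots> \<le> K * (l ^ n * norm h)"
    using norm_bounded[of h x] assms(3) K(2) by (intro mult_left_mono) auto
  finally show "norm ((ruelle f ^^ n) \<phi> x) \<le> norm h / c * l ^ n * norm \<phi>"
    by (simp add: K_def mult.commute mult.left_commute)
qed

section \<open>The spectral radius\<close>

text \<open>The complexification of \<open>c T\<^sup>n\<close>.\<close>

definition complexified_power ::
  "('a::real_normed_vector \<Rightarrow> 'a) \<Rightarrow> complex \<Rightarrow> nat \<Rightarrow> ('a \<times> 'a) \<Rightarrow>\<^sub>L ('a \<times> 'a)" where
  "complexified_power T c n = Blinfun (\<lambda>(u, v).
     (Re c *\<^sub>R (T ^^ n) u - Im c *\<^sub>R (T ^^ n) v, Im c *\<^sub>R (T ^^ n) u + Re c *\<^sub>R (T ^^ n) v))"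

lemma bounded_linear_power:
  fixes T :: "'a::real_normed_vector \<Rightarrow> 'a"
  shows "bounded_linear T \<Longrightarrow> bounded_linear (T ^^ n)"
proof (induction n)
  case 0
  then show ?case by (simp add: id_def bounded_linear_ident)
next
  case (Suc n)
  then show ?case
    using bounded_linear_compose[of T "T ^^ n"] by (simp add: comp_def)
qed

lemma complexified_power_apply:
  assumes "bounded_linear T"
  shows "complexified_power T c n (u, v) =
     (Re c *\<^sub>R (T ^^ n) u - Im c *\<^sub>R (T ^^ n) v, Im c *\<^sub>R (T ^^ n) u + Re c *\<^sub>R (T ^^ n) v)"
proof -
  have [THEN bounded_linear_compose, bounded_linear_intros]: "bounded_linear (T ^^ n)"
    using assms by (rule bounded_linear_power)
  have "bounded_linear (\<lambda>p. (Re c *\<^sub>R (T ^^ n) (fst p) - Im c *\<^sub>R (T ^^ n) (snd p),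
      Im c *\<^sub>R (T ^^ n) (fst p) + Re c *\<^sub>R (T ^^ n) (snd p)))"
    by (intro bounded_linear_intros)
  then show ?thesis
    unfolding complexified_power_def by (simp add: bounded_linear_Blinfun_apply case_prod_beta')
qed

lemma complexified_power_compose:
  assumes "bounded_linear T"
  shows "complexified_power T c m o\<^sub>L complexified_power T d n = complexified_power T (c * d) (m + n)"
proof (rule blinfun_eqI)
  fix p :: "'a \<times> 'a"
  obtain u v where p: "p = (u, v)" by (cases p)
  have lin: "linear (T ^^ m)"
    using bounded_linear_power[OF assms] by (rule bounded_linear.linear)
  show "(complexified_power T c m o\<^sub>L complexified_power T d n) p = complexified_power T (c * d) (m + n) p"
    unfolding p by (simp add: complexified_power_apply[OF assms] linear_add[OF lin] linear_diff[OF lin]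
        linear_scale[OF lin] funpow_add algebra_simps)
qed

lemma complexified_shift_eq:
  assumes "bounded_linear T"
  shows "complexified_shift T z = blinfun_apply (complexified_power T z 0 - complexified_power T 1 1)"
  by (auto simp: complexified_shift_def complexified_power_apply[OF assms] minus_blinfun.rep_eq fun_eq_iff)

lemma norm_complexified_power_le:
  assumes "bounded_linear T" and "\<And>x. norm ((T ^^ n) x) \<le> K * norm x" and "0 \<le> K"
  shows "norm (complexified_power T c n) \<le> 4 * cmod c * K"
proof (rule norm_blinfun_bound)
  fix p :: "'a \<times> 'a"
  obtain u v where p: "p = (u, v)" by (cases p)
  have uv: "norm ((T ^^ n) u) \<le> K * norm p" "norm ((T ^^ n) v) \<le> K * norm p"
    using assms(2)[of u] assms(2)[of v] norm_fst_le[of u v] norm_snd_le[of v u] assms(3)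
    unfolding p by (meson mult_left_mono order_trans)+
  have sc: "norm (r *\<^sub>R (T ^^ n) w) \<le> cmod c * (K * norm p)"
    if "\<bar>r\<bar> \<le> cmod c" "norm ((T ^^ n) w) \<le> K * norm p" for r w
    using that by (auto intro: mult_mono)
  have "norm (complexified_power T c n p)
      \<le> norm (Re c *\<^sub>R (T ^^ n) u - Im c *\<^sub>R (T ^^ n) v) + norm (Im c *\<^sub>R (T ^^ n) u + Re c *\<^sub>R (T ^^ n) v)"
    unfolding p complexified_power_apply[OF assms(1)] by (rule norm_Pair_le)
  also have "\<dots> \<le> (norm (Re c *\<^sub>R (T ^^ n) u) + norm (Im c *\<^sub>R (T ^^ n) v))
      + (norm (Im c *\<^sub>R (T ^^ n) u) + norm (Re c *\<^sub>R (T ^^ n) v))"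
    by (intro add_mono norm_triangle_ineq norm_triangle_ineq4)
  also have "\<dots> \<le> (cmod c * (K * norm p) + cmod c * (K * norm p))
      + (cmod c * (K * norm p) + cmod c * (K * norm p))"
    by (intro add_mono sc uv abs_Re_le_cmod abs_Im_le_cmod)
  finally show "norm (complexified_power T c n p) \<le> 4 * cmod c * K * norm p"
    by (simp add: algebra_simps)
qed (use assms(3) in simp)

text \<open>The inverse of \<open>z - T\<close> is the Neumann series with terms \<open>A n\<close>,
  dominated by a geometric series of ratio \<open>q = l / cmod z\<close>. Composing with
  \<open>S\<close>, the complexified \<open>z - T\<close>, telescopes it: each term becomes
  \<open>B n - B (Suc n)\<close>, where \<open>B 0\<close> is the identity and \<open>B n\<close>
  tends to 0.\<close>

lemma not_in_spectrum:
  fixes T :: "'a::banach \<Rightarrow> 'a"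
  assumes T: "bounded_linear T" and bound: "\<And>n x. norm ((T ^^ n) x) \<le> K * l ^ n * norm x"
    and "0 \<le> K" "0 < l" "l < cmod z"
  shows "z \<notin> spectrum T"
proof -
  define q where "q = l / cmod z"
  have z: "z \<noteq> 0" "0 < cmod z" using assms(4,5) by auto
  have q: "0 \<le> q" "q < 1" using assms(4,5) by (auto simp: q_def divide_simps)
  define A where "A n = complexified_power T (inverse z ^ Suc n) n" for n
  define B where "B n = complexified_power T (inverse z ^ n) n" for n
  define S where "S = complexified_power T z 0 - complexified_power T 1 1"
  have norm_le: "norm (complexified_power T c n) \<le> 4 * cmod c * (K * l ^ n)" for c n
    by (rule norm_complexified_power_le) (use assms bound in auto)
  have pow: "4 * cmod (inverse z ^ n) * (K * l ^ n) = 4 * K * q ^ n" for n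
    by (simp add: q_def norm_power norm_inverse divide_inverse power_inverse power_mult_distrib)
  have B0: "B \<longlonglongrightarrow> 0"
  proof (rule Lim_null_comparison)
    show "\<forall>\<^sub>F n in sequentially. norm (B n) \<le> 4 * K * q ^ n"
      unfolding B_def pow[symmetric] by (intro always_eventually allI norm_le)
    show "(\<lambda>n. 4 * K * q ^ n) \<longlonglongrightarrow> 0"
      using q by (intro tendsto_mult_right_zero LIMSEQ_realpow_zero) auto
  qed
  have "summable A"
  proof (rule summable_comparison_test'[of "\<lambda>n. 4 * K / cmod z * q ^ n" 0])
    show "summable (\<lambda>n. 4 * K / cmod z * q ^ n)"
      using q by (intro summable_mult summable_geometric) auto
    show "norm (A n) \<le> 4 * K / cmod z * q ^ n" for n
    proof -
      have "4 * cmod (inverse z ^ Suc n) * (K * l ^ n) = 4 * cmod (inverse z ^ n) * (K * l ^ n) / cmod z"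
        by (simp add: norm_mult norm_inverse norm_power divide_inverse)
      then show ?thesis
        using norm_le[of "inverse z ^ Suc n" n] unfolding A_def pow by simp
    qed
  qed
  then have A: "A sums suminf A" by (rule summable_sums)
  have tel: "(\<lambda>n. B n - B (Suc n)) sums (B 0 - 0)"
    by (rule telescope_sums'[OF B0])
  have cancel: "z * (inverse z * w) = w" "inverse z * w * z = w" for w
    using z by simp_all
  have "S o\<^sub>L A n = B n - B (Suc n)" "A n o\<^sub>L S = B n - B (Suc n)" for n
    by (simp_all add: cancel S_def A_def B_def bounded_bilinear.diff_left[OF bounded_bilinear_blinfun_compose]
        bounded_bilinear.diff_right[OF bounded_bilinear_blinfun_compose] complexified_power_compose[OF T])
  then have "(\<lambda>n. S o\<^sub>L A n) sums B 0" "(\<lambda>n. A n o\<^sub>L S) sums B 0"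
    using tel by simp_all
  moreover have "(\<lambda>n. S o\<^sub>L A n) sums (S o\<^sub>L suminf A)" "(\<lambda>n. A n o\<^sub>L S) sums (suminf A o\<^sub>L S)"
    by (rule bounded_linear.sums[OF bounded_bilinear.bounded_linear_right[OF bounded_bilinear_blinfun_compose] A]
        bounded_linear.sums[OF bounded_bilinear.bounded_linear_left[OF bounded_bilinear_blinfun_compose] A])+
  ultimately have comp: "S o\<^sub>L suminf A = B 0" "suminf A o\<^sub>L S = B 0"
    by (metis sums_unique2)+
  have B0_id: "blinfun_apply (B 0) = id"
    by (auto simp: fun_eq_iff B_def complexified_power_apply[OF T])
  have "suminf A \<circ> S = blinfun_apply (suminf A o\<^sub>L S)" "S \<circ> suminf A = blinfun_apply (S o\<^sub>L suminf A)"
    by (simp_all add: fun_eq_iff)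
  then have "suminf A \<circ> complexified_shift T z = id" "complexified_shift T z \<circ> suminf A = id"
    unfolding complexified_shift_eq[OF T] S_def[symmetric] by (simp_all add: comp B0_id)
  then show ?thesis
    unfolding spectrum_def using blinfun.bounded_linear_right[of "suminf A"] by blast
qed

text \<open>The pair \<open>(h, 0)\<close> is a nonzero element of the kernel of the shift, which
  therefore has no left inverse.\<close>

lemma eigenvalue_in_spectrum:
  assumes "T h = l *\<^sub>R h" "h \<noteq> 0" "T 0 = 0"
  shows "complex_of_real l \<in> spectrum T"
proof -
  have "complexified_shift T (complex_of_real l) (h, 0) = complexified_shift T (complex_of_real l) 0"
    using assms by (simp add: complexified_shift_def zero_prod_def)
  then have "(h, 0) = (0 :: 'a \<times> 'a)" if "R \<circ> complexified_shift T (complex_of_real l) = id" for R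
    using that by (metis comp_apply id_apply)
  then show ?thesis
    using assms(2) by (auto simp: spectrum_def zero_prod_def)
qed

text \<open>The eigenvalue \<open>l\<close> itself lies in the spectrum, and the Neumann series
  excludes every larger modulus. So the supremum defining the spectral radius is attained at
  \<open>l\<close>.\<close>

lemma main_eigenvalue_eqI:
  fixes T :: "'a::banach \<Rightarrow> 'a"
  assumes "bounded_linear T" "\<And>n x. norm ((T ^^ n) x) \<le> K * l ^ n * norm x" "0 \<le> K" "0 < l"
    and h: "T h = l *\<^sub>R h" "h \<noteq> 0"
  shows "main_eigenvalue T = l"
proof -
  have "complex_of_real l \<in> spectrum T"
    by (rule eigenvalue_in_spectrum[where T = T, OF h]) (rule linear_0[OF bounded_linear.linear[OF assms(1)]])
  then have "spectral_radius T = l"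
    unfolding spectral_radius_def
    using not_in_spectrum[OF assms(1-4)] assms(4)
    by (intro cSup_eq_maximum) (force simp: image_iff not_less[symmetric])+
  moreover have "is_eigenvalue T l"
    using h by (auto simp: is_eigenvalue_def)
  ultimately show ?thesis
    unfolding main_eigenvalue_def by blast
qed

section \<open>Variation of the Brownian potential\<close>

text \<open>Markov's inequality for \<open>X ^ 4\<close>. Second moments would be too weak: for
  \<open>2 ^ m\<close> increments of variance \<open>1 / 2 ^ m\<close> and a threshold
  \<open>r ^ m\<close> with \<open>r < 1\<close>, the union bound would be
  \<open>1 / r ^ (2 * m)\<close>.\<close>

lemma (in prob_space) normal_fourth_moment_tail:
  assumes X: "distributed M lborel X (normal_density 0 \<sigma>)" and "0 < \<sigma>" "0 < c"
  shows "prob {\<omega> \<in> space M. c \<le> \<bar>X \<omega>\<bar>} \<le> 3 * \<sigma> ^ 4 / c ^ 4"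
proof -
  have m: "has_bochner_integral lborel (\<lambda>x. normal_density 0 \<sigma> x * x ^ 4) (3 * \<sigma> ^ 4)"
  proof -
    have eq: "fact (2 * 2) / ((2 / \<sigma>\<^sup>2) ^ 2 * fact 2) = 3 * \<sigma> ^ 4"
      by (simp add: fact_numeral power_divide flip: power_mult)
    show ?thesis using normal_moment_even[of \<sigma> 0 2, unfolded eq] assms(2) by simp
  qed
  have "integrable M (\<lambda>\<omega>. X \<omega> ^ 4)"
    using distributed_integrable[OF X, of "\<lambda>x. x ^ 4"] m by (auto simp: has_bochner_integral_iff)
  moreover have "(\<integral>\<omega>. X \<omega> ^ 4 \<partial>M) = 3 * \<sigma> ^ 4"
    using distributed_integral[OF X, of "\<lambda>x. x ^ 4"] m by (auto simp: has_bochner_integral_iff)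
  moreover have "c \<le> \<bar>x\<bar> \<longleftrightarrow> c ^ 4 \<le> x ^ 4" for x :: real
    using power_mono_iff[of c "\<bar>x\<bar>" 4] assms(3) by (simp add: power_even_abs)
  ultimately show ?thesis
    using integral_Markov_inequality_measure[of M "\<lambda>\<omega>. X \<omega> ^ 4" "{}" "c ^ 4"] assms(3) by simp
qed

text \<open>A union bound over the \<open>2 ^ m\<close> intervals of level \<open>m\<close> gives a
  geometrically small probability for a large increment, and Borel-Cantelli applies.\<close>

lemma (in brownian_motion_01) dyadic_increments:
  "AE \<omega> in M. \<forall>\<^sub>F m in sequentially. \<forall>k<2 ^ m.
     \<bar>B (real (Suc k) / 2 ^ m) \<omega> - B (real k / 2 ^ m) \<omega>\<bar> \<le> (9 / 10) ^ m"
proof -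
  define E where "E m k = {\<omega> \<in> space M.
    (9 / 10) ^ m \<le> \<bar>B (real (Suc k) / 2 ^ m) \<omega> - B (real k / 2 ^ m) \<omega>\<bar>}" for m k :: nat
  define A where "A m = (\<Union>k<2 ^ m. E m k)" for m
  have E: "E m k \<in> sets M" "prob (E m k) \<le> 3 * ((1 / 2 ^ m) ^ 2 / ((9 / 10) ^ m) ^ 4)"
    if "k < 2 ^ m" for m k
  proof -
    have k: "real (Suc k) \<le> 2 ^ m"
      using that by (metis Suc_leI numeral_power_le_of_nat_cancel_iff of_nat_le_numeral_power_cancel_iff)
    have "distributed M lborel (\<lambda>\<omega>. B (real (Suc k) / 2 ^ m) \<omega> - B (real k / 2 ^ m) \<omega>)
        (normal_density 0 (sqrt (real (Suc k) / 2 ^ m - real k / 2 ^ m)))"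
      using k by (intro gaussian_increments) (auto simp: divide_simps)
    moreover have "real (Suc k) / 2 ^ m - real k / 2 ^ m = 1 / 2 ^ m"
      by (simp add: diff_divide_distrib[symmetric])
    ultimately have X: "distributed M lborel (\<lambda>\<omega>. B (real (Suc k) / 2 ^ m) \<omega> - B (real k / 2 ^ m) \<omega>)
        (normal_density 0 (sqrt (1 / 2 ^ m)))"
      by simp
    have [measurable]: "(\<lambda>\<omega>. B (real (Suc k) / 2 ^ m) \<omega> - B (real k / 2 ^ m) \<omega>) \<in> borel_measurable M"
      using distributed_measurable[OF X] by simp
    show "E m k \<in> sets M" unfolding E_def by measurable
    have "sqrt (1 / 2 ^ m) ^ 4 = ((sqrt (1 / 2 ^ m))\<^sup>2)\<^sup>2"
      by (simp only: power_mult[symmetric]) simp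
    also have "\<dots> = (1 / 2 ^ m)\<^sup>2" by simp
    finally show "prob (E m k) \<le> 3 * ((1 / 2 ^ m) ^ 2 / ((9 / 10) ^ m) ^ 4)"
      using normal_fourth_moment_tail[OF X, of "(9 / 10) ^ m"] by (simp add: E_def)
  qed
  have A_sets: "A m \<in> sets M" for m
    unfolding A_def using E(1) by auto
  have A_le: "prob (A m) \<le> 3 * (5000 / 6561) ^ m" for m
  proof -
    have "prob (A m) \<le> (\<Sum>k<2 ^ m. prob (E m k))"
      unfolding A_def using E(1) by (intro finite_measure_subadditive_finite) auto
    also have "\<dots> \<le> (\<Sum>k<2 ^ m :: nat. 3 * ((1 / 2 ^ m) ^ 2 / ((9 / 10) ^ m) ^ 4))"
      using E(2) by (intro sum_mono) auto
    also have "\<dots> = 3 * (2 ^ m * (1 / 2 ^ m) ^ 2 / ((9 / 10) ^ 4) ^ m)"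
      by (simp flip: power_mult add: mult.commute)
    \<comment> \<open>\<open>9/10\<close> may be any \<open>r < 1\<close> with \<open>2 r\<^sup>4 > 1\<close>; here \<open>1 / (2 r\<^sup>4) = 5000/6561\<close>.\<close>
    also have "2 ^ m * (1 / 2 ^ m) ^ 2 / ((9 / 10) ^ 4) ^ m = (5000 / 6561 :: real) ^ m"
      by (simp add: power2_eq_square power_divide[symmetric] power_mult_distrib[symmetric])
        (simp add: power_divide field_simps flip: power_mult_distrib)
    finally show ?thesis .
  qed
  have "summable (\<lambda>m. prob (A m))"
  proof (rule summable_comparison_test'[of "\<lambda>m. 3 * (5000 / 6561) ^ m" 0])
    show "summable (\<lambda>m. 3 * (5000 / 6561 :: real) ^ m)"
      by (intro summable_mult summable_geometric) auto
  qed (use A_le in simp)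
  then have "AE \<omega> in M. \<forall>\<^sub>F m in sequentially. \<omega> \<in> space M - A m"
    using A_sets by (intro borel_cantelli_AE1) (auto simp: emeasure_eq_measure)
  then show ?thesis
    by eventually_elim (erule eventually_mono, auto simp: A_def E_def not_le intro: less_imp_le)
qed

section \<open>Chaining along dyadic points\<close>

definition binary_partial :: "omega \<Rightarrow> nat \<Rightarrow> real" where
  "binary_partial x m = (\<Sum>i<m. (1/2) ^ Suc i * of_bool (x i))"

lemma binary_partial_dyadic: "\<exists>k<2 ^ m. binary_partial x m = real k / 2 ^ m"
proof (induction m)
  case 0
  then show ?case by (auto simp: binary_partial_def)
next
  case (Suc m)
  then obtain k where k: "k < 2 ^ m" "binary_partial x m = real k / 2 ^ m" by blast
  have "binary_partial x (Suc m) = real (2 * k + of_bool (x m)) / 2 ^ Suc m"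
    using k(2) by (simp add: binary_partial_def field_simps power_divide)
  moreover have "2 * k + of_bool (x m) < 2 ^ Suc m"
    using k(1) by (cases "x m") auto
  ultimately show ?case by blast
qed

lemma binary_partial_tendsto: "binary_partial x \<longlonglongrightarrow> binary_value x"
  unfolding binary_partial_def[abs_def] binary_value_def
  by (rule summable_LIMSEQ[OF summable_binary_value])

text \<open>From level \<open>m\<close> to \<open>Suc m\<close> the truncation either stays put or
  moves to the right neighbour in the grid of level \<open>Suc m\<close>, which changes
  \<open>b\<close> by at most \<open>r ^ Suc m\<close>. These changes form a geometric series, and
  continuity passes from the truncations to the point itself.\<close>

lemma dyadic_chaining:
  fixes b :: "real \<Rightarrow> real"
  assumes cont: "continuous_on {0..1} b" and r: "0 < r" "r < 1"
    and incr: "\<And>m k. N \<le> m \<Longrightarrow> k < 2 ^ m \<Longrightarrow> \<bar>b (real (Suc k) / 2 ^ m) - b (real k / 2 ^ m)\<bar> \<le> r ^ m"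
    and "N \<le> n"
  shows "\<bar>b (binary_value x) - b (binary_partial x n)\<bar> \<le> r ^ Suc n / (1 - r)"
proof -
  have step: "\<bar>b (binary_partial x (Suc m)) - b (binary_partial x m)\<bar> \<le> r ^ Suc m" if "N \<le> m" for m
  proof -
    obtain k where k: "k < 2 ^ m" "binary_partial x m = real k / 2 ^ m"
      using binary_partial_dyadic by blast
    have eq: "binary_partial x m = real (2 * k) / 2 ^ Suc m"
      using k(2) by simp
    have eq': "binary_partial x (Suc m) = real (2 * k + of_bool (x m)) / 2 ^ Suc m"
      using k(2) by (simp add: binary_partial_def field_simps power_divide)
    show ?thesis
      using incr[of "Suc m" "2 * k"] k(1) that r unfolding eq eq' by (cases "x m") auto
  qed
  have chain: "\<bar>b (binary_partial x (n + j)) - b (binary_partial x n)\<bar>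
      \<le> (r ^ Suc n - r ^ Suc (n + j)) / (1 - r)" for j
  proof (induction j)
    case 0
    then show ?case by simp
  next
    case (Suc j)
    have "(r ^ Suc n - r ^ Suc (n + Suc j)) / (1 - r)
        = (r ^ Suc n - r ^ Suc (n + j)) / (1 - r) + r ^ Suc (n + j)"
      using r by (simp add: field_simps)
    then show ?case
      using Suc step[of "n + j"] \<open>N \<le> n\<close> by simp
  qed
  have "(\<lambda>m. b (binary_partial x m)) \<longlonglongrightarrow> b (binary_value x)"
  proof (rule continuous_on_tendsto_compose[OF cont binary_partial_tendsto binary_value_in_01])
    have "binary_partial x m \<in> {0..1}" for m
    proof -
      obtain k where k: "k < 2 ^ m" "binary_partial x m = real k / 2 ^ m"
        using binary_partial_dyadic by blast
      have "real k \<le> 2 ^ m" using k(1) by (metis less_imp_le of_nat_le_numeral_power_cancel_iff)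
      then show ?thesis using k(2) by simp
    qed
    then show "\<forall>\<^sub>F m in sequentially. binary_partial x m \<in> {0..1}" by simp
  qed
  then have "(\<lambda>j. b (binary_partial x (n + j))) \<longlonglongrightarrow> b (binary_value x)"
    by (subst add.commute) (rule LIMSEQ_ignore_initial_segment)
  then have "(\<lambda>j. \<bar>b (binary_partial x (n + j)) - b (binary_partial x n)\<bar>)
      \<longlonglongrightarrow> \<bar>b (binary_value x) - b (binary_partial x n)\<bar>"
    by (intro tendsto_intros)
  then show ?thesis
  proof (rule LIMSEQ_le_const2, intro exI allI impI)
    fix j :: nat
    have "(r ^ Suc n - r ^ Suc (n + j)) / (1 - r) \<le> r ^ Suc n / (1 - r)"
      using r by (intro divide_right_mono) auto
    then show "\<bar>b (binary_partial x (n + j)) - b (binary_partial x n)\<bar> \<le> r ^ Suc n / (1 - r)"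
      using chain[of j] by linarith
  qed
qed

lemma dyadic_increments_summable_variation:
  assumes cont: "continuous_on {0..1} (\<lambda>t. B t \<omega>)" and r: "0 < r" "r < 1"
    and incr: "\<And>m k. N \<le> m \<Longrightarrow> k < 2 ^ m \<Longrightarrow>
      \<bar>B (real (Suc k) / 2 ^ m) \<omega> - B (real k / 2 ^ m) \<omega>\<bar> \<le> r ^ m"
  shows "\<exists>v. summable_variation (brownian_potential B \<omega>) v"
proof -
  define f where "f = brownian_potential B \<omega>"
  have f: "f x = B (binary_value x) \<omega>" for x
    unfolding f_def by (rule apply_brownian_potential[of B, OF cont])
  \<comment> \<open>The second summand is twice the chaining error, for points with a common
    truncation at level \<open>n \<ge> N\<close>. The first covers \<open>n < N\<close>, where
    \<open>r ^ n / r ^ N\<close> is at least 1 and the trivial bound \<open>2 * norm f\<close>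
    suffices.\<close>
  define v where "v n = (2 * norm f / r ^ N + 2 * r / (1 - r)) * r ^ n" for n
  have "summable_variation f v"
  proof
    show "summable v"
      unfolding v_def[abs_def] using r by (intro summable_mult summable_geometric) auto
    fix n :: nat and x y :: omega
    assume eq: "\<And>i. i < n \<Longrightarrow> x i = y i"
    show "\<bar>f x - f y\<bar> \<le> v n"
    proof (cases "N \<le> n")
      case True
      have "binary_partial x n = binary_partial y n"
        unfolding binary_partial_def using eq by (intro sum.cong) auto
      then have "\<bar>f x - f y\<bar> \<le> 2 * (r ^ Suc n / (1 - r))"
        using dyadic_chaining[OF cont r incr True, of x] dyadic_chaining[OF cont r incr True, of y]
        by (simp add: f)
      also have "\<dots> \<le> v n"
        using r by (simp add: v_def algebra_simps)
      finally show ?thesis .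
    next
      case False
      have "\<bar>f x - f y\<bar> \<le> 2 * norm f"
        using norm_bounded[of f x] norm_bounded[of f y] by simp
      also have "\<dots> = 2 * norm f / r ^ N * r ^ N" using r by simp
      also have "\<dots> \<le> 2 * norm f / r ^ N * r ^ n"
        using r False by (intro mult_left_mono power_decreasing) auto
      also have "\<dots> \<le> v n"
        using r by (simp add: v_def algebra_simps)
      finally show ?thesis .
    qed
  qed
  then show ?thesis unfolding f_def by blast
qed

section \<open>The eigenvalue formula\<close>

theorem mainTheorem5:
  fixes M :: "'w measure" and B :: "real \<Rightarrow> 'w \<Rightarrow> real"
  assumes "brownian_motion_01 M B"
  shows "AE \<omega> in M.
    let L = ruelle (brownian_potential B \<omega>);
        ratio = (\<lambda>n. apply_bcontfun ((L ^^ n) (const_bcontfun 1)) (case_nat True (\<lambda>_. False)) /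
                     apply_bcontfun ((L ^^ n) (const_bcontfun 1)) (\<lambda>_. False))
    in convergent ratio \<and> main_eigenvalue L = 1 + exp (B (1/2) \<omega>) * lim ratio"
proof -
  interpret brownian_motion_01 M B by (rule assms)
  define z :: omega where "z = (\<lambda>_. False)"
  have z: "case_nat False z = z"
    by (auto simp: z_def fun_eq_iff split: nat.split)
  have value_z: "binary_value z = 0"
    by (simp add: binary_value_def z_def)
  have value_1z: "binary_value (case_nat True z) = 1 / 2"
    unfolding binary_value_def by (subst suminf_finite[of "{0}"]) (auto simp: z_def split: nat.split)
  from start continuous_paths dyadic_increments show ?thesis
  proof eventually_elim
    case (elim \<omega>)
    define f where "f = brownian_potential B \<omega>"
    obtain N where "\<And>m k. N \<le> m \<Longrightarrow> k < 2 ^ m \<Longrightarrow>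
        \<bar>B (real (Suc k) / 2 ^ m) \<omega> - B (real k / 2 ^ m) \<omega>\<bar> \<le> (9 / 10) ^ m"
      using elim(3) unfolding eventually_sequentially by blast
    from dyadic_increments_summable_variation[where B = B and r = "9 / 10", OF elim(2) _ _ this]
    obtain v where "summable_variation f v"
      unfolding f_def by auto
    then interpret summable_variation f v .
    obtain c h l where c: "0 < c" "\<And>x. c \<le> apply_bcontfun h x" and l: "0 < l" "ruelle f h = l *\<^sub>R h"
      and ratio: "\<And>x y. (\<lambda>n. iter_one n x / iter_one n y) \<longlonglongrightarrow> h x / h y"
      using ex_eigenfunction by blast
    have hz: "0 < h z" using c(1) c(2)[of z] by linarith
    have "main_eigenvalue (ruelle f) = l"
    proof (rule main_eigenvalue_eqI[OF bounded_linear_ruelle norm_ruelle_power_le[OF c l]])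
      show "0 \<le> norm h / c" using c(1) by simp
      show "h \<noteq> 0" using hz by auto
    qed (use l in auto)
    \<comment> \<open>The preimages of \<open>z\<close> are \<open>z\<close> itself, with weight 1
      because the path starts at 0, and \<open>case_nat True z\<close>, which codes the time
      1/2.\<close>
    moreover have "l * h z = h z + exp (B (1/2) \<omega>) * h (case_nat True z)"
      using arg_cong[OF l(2), of "\<lambda>g. apply_bcontfun g z"] elim(1)
      by (simp add: ruelle_expand z f_def apply_brownian_potential[of B, OF elim(2)] value_z value_1z)
    then have "l = 1 + exp (B (1/2) \<omega>) * (h (case_nat True z) / h z)"
      using hz by (simp add: field_simps)
    moreover have lim: "(\<lambda>n. (ruelle f ^^ n) (const_bcontfun 1) (case_nat True z) /
        (ruelle f ^^ n) (const_bcontfun 1) z) \<longlonglongrightarrow> h (case_nat True z) / h z"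
      using ratio by (simp add: iter_one_def)
    ultimately show ?case
      using convergentI[OF lim] limI[OF lim] by (simp add: Let_def flip: f_def z_def)
  qed
qed

end
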